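(* Five lines in general position in $\mathbb{P}_5$ can be put in the following form: $$\epsilon_0\wedge\epsilon_3,\quad \epsilon_1\wedge\epsilon_4,\quad \epsilon_2\wedge\epsilon_5,\quad (\epsilon_0+\epsilon_1+\epsilon_2)\wedge(\epsilon_3+\epsilon_4+\epsilon_5),$$ $$(-\epsilon_0+v\,\epsilon_4-\epsilon_5)\wedge(u\,\epsilon_1-\epsilon_2+a_{1,2,4}\,\epsilon_3+e_1\,\epsilon_4+e_2\,\epsilon_5)$$ for some basis $(\epsilon_i)_{0\le i\le5}$ of $V_6$ and some complex parameters $u,v,a_{1,2,4},e_1,e_2$.
   Context: Over $\mathbb{C}$. A line in the five-dimensional projective space is identified with a $2$-dimensional subspace of a $6$-dimensional vector space $V_6$, i.e. with a point of $G(2,V_6)\subset\mathbb{P}(\bigwedge^2V_6)$, represented (up to a nonzero scalar) by a decomposable bivector in $\bigwedge^2V_6$. "In general position" means that the $5$-tuple of lines lies in a suitable nonempty Zariski open subset of $G(2,V_6)^5$. *)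

theory Defs
  imports "HOL-Analysis.Analysis"
begin

type_synonym V6 = "complex ^ 6"

text \<open>
  The exterior square of \<open>V6\<close> is modelled by the antisymmetric tensors in \<open>complex ^ (6 \<times> 6)\<close>:
  the entry at \<open>(i, j)\<close> with \<open>i < j\<close> of such a tensor is its coordinate on the
  \<open>(i, j)\<close>-th standard basis bivector, so the entries of \<open>x \<wedge> y\<close> are
  the Pluecker coordinates, up to sign and repetition.  A flat index type is used so that \<open>(*s)\<close> is
  the scalar multiplication on tensors.
\<close>
type_synonym tensor2 = "complex ^ (6 \<times> 6)"

definition wedge :: "V6 \<Rightarrow> V6 \<Rightarrow> tensor2"  (infix "\<and>\<and>" 72)
  where "x \<and>\<and> y = (\<chi> p. x $ fst p * y $ snd p - x $ snd p * y $ fst p)"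

definition basis6 :: "(6 \<Rightarrow> V6) \<Rightarrow> bool"
  where "basis6 \<epsilon> \<longleftrightarrow> inj \<epsilon> \<and> vec.independent (range \<epsilon>) \<and> vec.span (range \<epsilon>) = UNIV"

definition G26 :: "V6 set set"
  where "G26 = {L. vec.subspace L \<and> vec.dim L = 2}"

definition represents :: "tensor2 \<Rightarrow> V6 set \<Rightarrow> bool"
  where "represents \<omega> L \<longleftrightarrow>
    (\<exists>x y c. x \<noteq> y \<and> vec.independent {x, y} \<and> vec.span {x, y} = L \<and> c \<noteq> 0 \<and> \<omega> = c *s (x \<and>\<and> y))"

definition G26_pow5 :: "(5 \<Rightarrow> V6 set) set"
  where "G26_pow5 = {L. \<forall>k. L k \<in> G26}"

text \<open>
  Polynomials in the tensor coordinates of five tensors, as functions; since the complex numbers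
  are infinite, these correspond bijectively to formal polynomials.
\<close>
inductive poly_fun :: "((5 \<Rightarrow> tensor2) \<Rightarrow> complex) \<Rightarrow> bool"
  where
    const: "poly_fun (\<lambda>\<omega>. c)"
  | coord: "poly_fun (\<lambda>\<omega>. \<omega> k $ p)"
  | add: "poly_fun f \<Longrightarrow> poly_fun g \<Longrightarrow> poly_fun (\<lambda>\<omega>. f \<omega> + g \<omega>)"
  | mult: "poly_fun f \<Longrightarrow> poly_fun g \<Longrightarrow> poly_fun (\<lambda>\<omega>. f \<omega> * g \<omega>)"

definition multihomogeneous :: "(5 \<Rightarrow> nat) \<Rightarrow> ((5 \<Rightarrow> tensor2) \<Rightarrow> complex) \<Rightarrow> bool"
  where "multihomogeneous d f \<longleftrightarrow>
    poly_fun f \<and> (\<forall>c \<omega>. f (\<lambda>k. c k *s \<omega> k) = (\<Prod>k\<in>UNIV. c k ^ d k) * f \<omega>)"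

text \<open>
  The Zariski topology on the fivefold product of the Grassmannian is the one induced by the
  product of Pluecker embeddings into a product of five projective spaces, whose closed sets are the
  common zero loci of multihomogeneous polynomials.
\<close>
definition zariski_closed :: "(5 \<Rightarrow> V6 set) set \<Rightarrow> bool"
  where "zariski_closed Z \<longleftrightarrow>
    (\<exists>F. (\<forall>f\<in>F. \<exists>d. multihomogeneous d f) \<and>
         Z = {L \<in> G26_pow5. \<forall>f\<in>F. \<forall>\<omega>. (\<forall>k. represents (\<omega> k) (L k)) \<longrightarrow> f \<omega> = 0})"

definition zariski_open :: "(5 \<Rightarrow> V6 set) set \<Rightarrow> bool"
  where "zariski_open U \<longleftrightarrow> U \<subseteq> G26_pow5 \<and> zariski_closed (G26_pow5 - U)"

end

theory Submission
  imports Defs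
begin

text \<open>
  For general lines, \<open>V\<^sub>6\<close> is the direct sum of the planes \<open>L\<^sub>0, L\<^sub>1, L\<^sub>2\<close>, and the fourth plane
  projects isomorphically to each of them.  This identifies \<open>V\<^sub>6\<close> with three copies of \<open>L\<^sub>3\<close>, and
  the bases that put the first four lines in the required form correspond to the bases \<open>a, b\<close> of
  \<open>L\<^sub>3\<close>.  The projections of the fifth plane are maps \<open>M\<^sub>0, M\<^sub>1, M\<^sub>2 : L\<^sub>4 \<rightarrow> L\<^sub>3\<close>.  Choose
  \<open>z \<noteq> 0\<close> in \<open>L\<^sub>4\<close> with \<open>M\<^sub>1 z\<close> and \<open>M\<^sub>2 z\<close> linearly dependent, which is a root of the binary
  quadratic form \<open>det (M\<^sub>1 z, M\<^sub>2 z)\<close>, and put \<open>a = - M\<^sub>0 z\<close> and \<open>b = - M\<^sub>2 z\<close>.  Then \<open>z\<close> is the first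
  vector of the normal form, and a multiple of the vector \<open>w\<close> with \<open>M\<^sub>0 w\<close> proportional to \<open>b\<close> is
  the second one.

  This works if the forms \<open>det (M\<^sub>1 z, M\<^sub>2 z)\<close> and \<open>det (M\<^sub>0 z, M\<^sub>2 z)\<close> have no common root.  Spanning
  vectors of the lines are read off linearly from the representing tensors and their coordinates
  follow by Cramer's rule, so the nonvanishing of the resultant, together with the nondegeneracy
  of the first four lines, is the nonvanishing of a multihomogeneous polynomial.
\<close>

section \<open>Pencils of pairs\<close>

lemma binary_quadratic_root:
  fixes a b c :: complex
  obtains s t where "s \<noteq> 0 \<or> t \<noteq> 0" "a * s\<^sup>2 + b * s * t + c * t\<^sup>2 = 0"
proof (cases "a = 0")
  case True
  then show ?thesis using that[of 1 0] by simp
next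
  case False
  define r where "r = csqrt (b\<^sup>2 - 4 * a * c)"
  have r: "r * r = b * b - 4 * a * c"
    unfolding r_def by (metis power2_csqrt power2_eq_square)
  have "a * (r - b)\<^sup>2 + b * (r - b) * (2 * a) + c * (2 * a)\<^sup>2 = 0"
    using r by (simp add: power2_eq_square) algebra
  then show ?thesis using that[of "r - b" "2 * a"] False by simp
qed

text \<open>This is the resultant of two binary quadratic forms as a Bezout determinant. The square
  is written as a product so that \<open>multihomogeneous_2x2\<close> applies to the outer
  difference.\<close>

definition quad_resultant :: "complex \<Rightarrow> complex \<Rightarrow> complex \<Rightarrow> complex \<Rightarrow> complex \<Rightarrow> complex \<Rightarrow> complex" where
  "quad_resultant a b c a' b' c' = (a * c' - c * a') * (a * c' - c * a') - (a * b' - b * a') * (b * c' - c * b')"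

text \<open>If \<open>s\<close> and \<open>t\<close> are both nonzero, eliminating the outer
  coefficients gives two linear equations in \<open>s\<close> and \<open>t\<close> whose determinant
  is the resultant. If just one of them is zero, two outer coefficients vanish, and with them the
  resultant.\<close>

lemma quad_resultant_common_root:
  fixes s t :: complex
  assumes "quad_resultant a b c a' b' c' \<noteq> 0"
    and f: "a * s\<^sup>2 + b * s * t + c * t\<^sup>2 = 0" and g: "a' * s\<^sup>2 + b' * s * t + c' * t\<^sup>2 = 0"
  shows "s = 0 \<and> t = 0"
proof (rule ccontr)
  assume st: "\<not> (s = 0 \<and> t = 0)"
  have "quad_resultant a b c a' b' c' = 0"
  proof (cases "s = 0 \<or> t = 0")
    case True
    then show ?thesis using f g st by (auto simp: quad_resultant_def)
  next
    case False
    have "s * ((a * c' - c * a') * s + (b * c' - c * b') * t) = 0"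
      using f g by algebra
    moreover have "t * ((a * b' - b * a') * s + (a * c' - c * a') * t) = 0"
      using f g by algebra
    ultimately have "(a * c' - c * a') * s + (b * c' - c * b') * t = 0"
      "(a * b' - b * a') * s + (a * c' - c * a') * t = 0" using False by auto
    then have "quad_resultant a b c a' b' c' * s * t = 0"
      unfolding quad_resultant_def by algebra
    then show ?thesis using False by simp
  qed
  with assms show False by simp
qed

lemma linear_2x2_solution:
  fixes a1 a2 b1 b2 w1 w2 :: complex
  assumes "a1 * b2 - a2 * b1 \<noteq> 0"
  obtains x y where "w1 = x * a1 + y * b1" "w2 = x * a2 + y * b2"
proof
  show "w1 = (w1 * b2 - w2 * b1) / (a1 * b2 - a2 * b1) * a1 + (a1 * w2 - a2 * w1) / (a1 * b2 - a2 * b1) * b1"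
    "w2 = (w1 * b2 - w2 * b1) / (a1 * b2 - a2 * b1) * a2 + (a1 * w2 - a2 * w1) / (a1 * b2 - a2 * b1) * b2"
    using assms by (simp_all add: divide_simps) algebra+
qed

lemma collinear_2:
  fixes b1 b2 w1 w2 :: complex
  assumes "w1 * b2 - w2 * b1 = 0" "b1 \<noteq> 0 \<or> b2 \<noteq> 0"
  obtains v where "w1 = v * b1" "w2 = v * b2"
proof (cases "b1 = 0")
  case True
  then show ?thesis using assms that[of "w2 / b2"] by auto
next
  case False
  then show ?thesis using assms that[of "w1 / b1"] by (auto simp: field_simps)
qed

text \<open>The pair \<open>(s * xa i + t * ya i, s * xb i + t * yb i)\<close> is
  \<open>M\<^sub>i z\<close> for \<open>z = (s, t)\<close>, and \<open>q i j\<close> is the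
  determinant of \<open>M\<^sub>i z\<close> and \<open>M\<^sub>j z\<close>. The equations are the
  two vectors of the normal form, read plane by plane with \<open>a = (a1, a2)\<close> and
  \<open>b = (b1, b2)\<close>.\<close>

lemma pencil_normal_form:
  fixes xa xb ya yb :: "6 \<Rightarrow> complex" and q :: "6 \<Rightarrow> 6 \<Rightarrow> complex \<Rightarrow> complex \<Rightarrow> complex"
  assumes q_def: "\<And>i j s t. q i j s t = (s * xa i + t * ya i) * (s * xb j + t * yb j)
                                   - (s * xb i + t * yb i) * (s * xa j + t * ya j)"
    and no_common_root: "\<And>s t. q 1 2 s t = 0 \<Longrightarrow> q 0 2 s t = 0 \<Longrightarrow> s = 0 \<and> t = 0"
  obtains s t s' t' a1 a2 b1 b2 u v \<alpha> e1 e2 where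
    "a1 * b2 - a2 * b1 \<noteq> 0"
    "s * xa 0 + t * ya 0 = - a1" "s * xb 0 + t * yb 0 = - a2"
    "s * xa 1 + t * ya 1 = v * b1" "s * xb 1 + t * yb 1 = v * b2"
    "s * xa 2 + t * ya 2 = - b1" "s * xb 2 + t * yb 2 = - b2"
    "s' * xa 0 + t' * ya 0 = \<alpha> * b1" "s' * xb 0 + t' * yb 0 = \<alpha> * b2"
    "s' * xa 1 + t' * ya 1 = u * a1 + e1 * b1" "s' * xb 1 + t' * yb 1 = u * a2 + e1 * b2"
    "s' * xa 2 + t' * ya 2 = - a1 + e2 * b1" "s' * xb 2 + t' * yb 2 = - a2 + e2 * b2"
proof -
  obtain s t where st: "s \<noteq> 0 \<or> t \<noteq> 0" and "(xa 1 * xb 2 - xb 1 * xa 2) * s\<^sup>2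
     + (xa 1 * yb 2 + ya 1 * xb 2 - xb 1 * ya 2 - yb 1 * xa 2) * s * t
     + (ya 1 * yb 2 - yb 1 * ya 2) * t\<^sup>2 = 0"
    by (rule binary_quadratic_root)
  then have q12: "q 1 2 s t = 0"
    unfolding q_def by algebra
  with st no_common_root have q02: "q 0 2 s t \<noteq> 0" by blast
  define a1 a2 b1 b2 where ab: "a1 = - (s * xa 0 + t * ya 0)" "a2 = - (s * xb 0 + t * yb 0)"
    "b1 = - (s * xa 2 + t * ya 2)" "b2 = - (s * xb 2 + t * yb 2)"
  have det: "a1 * b2 - a2 * b1 \<noteq> 0"
    using q02 by (simp add: q_def ab algebra_simps)
  then have b: "b1 \<noteq> 0 \<or> b2 \<noteq> 0" by auto
  have "(s * xa 1 + t * ya 1) * b2 - (s * xb 1 + t * yb 1) * b1 = 0"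
    using q12 unfolding q_def ab by algebra
  then obtain v where v: "s * xa 1 + t * ya 1 = v * b1" "s * xb 1 + t * yb 1 = v * b2"
    using b collinear_2 by metis
  \<comment> \<open>a combination whose component 0 is proportional to the vector \<open>(b1, b2)\<close>; it is rescaled
      at the end so that its component 2 becomes \<open>- (a1, a2)\<close> modulo \<open>(b1, b2)\<close>\<close>
  define \<sigma> \<tau> where "\<sigma> = ya 0 * b2 - yb 0 * b1" and "\<tau> = - (xa 0 * b2 - xb 0 * b1)"
  have "\<sigma> \<noteq> 0 \<or> \<tau> \<noteq> 0"
    using det unfolding \<sigma>_def \<tau>_def ab by algebra
  have 0: "(\<sigma> * xa 0 + \<tau> * ya 0) * b2 - (\<sigma> * xb 0 + \<tau> * yb 0) * b1 = 0"
    unfolding \<sigma>_def \<tau>_def by algebra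
  then obtain \<beta> where \<beta>: "\<sigma> * xa 0 + \<tau> * ya 0 = \<beta> * b1" "\<sigma> * xb 0 + \<tau> * yb 0 = \<beta> * b2"
    using b collinear_2 by metis
  \<comment> \<open>By the choice of \<open>\<sigma>\<close> and \<open>\<tau>\<close> this
    determinant equals \<open>a1 * b2 - a2 * b1\<close>.\<close>
  have indep: "s * \<tau> - t * \<sigma> \<noteq> 0"
    using det unfolding \<sigma>_def \<tau>_def ab by algebra
  obtain x y where xy: "\<sigma> * xa 2 + \<tau> * ya 2 = x * a1 + y * b1" "\<sigma> * xb 2 + \<tau> * yb 2 = x * a2 + y * b2"
    using linear_2x2_solution[OF det] by metis
  \<comment> \<open>otherwise a combination with vanishing component 2 would be a common root\<close>
  have "x \<noteq> 0"
  proof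
    assume "x = 0"
    \<comment> \<open>Component 2 of \<open>(s, t)\<close> is \<open>- (b1, b2)\<close>, so adding
      \<open>y\<close> times \<open>(s, t)\<close> cancels what is left of component 2.\<close>
    define s' t' where "s' = \<sigma> + y * s" and "t' = \<tau> + y * t"
    have z: "s' * xa 2 + t' * ya 2 = 0" "s' * xb 2 + t' * yb 2 = 0"
      using xy \<open>x = 0\<close> unfolding ab s'_def t'_def by algebra+
    then have "q 1 2 s' t' = 0" "q 0 2 s' t' = 0"
      by (simp_all add: q_def)
    then have "s' = 0" "t' = 0" using no_common_root by blast+
    then have "s * \<tau> - t * \<sigma> = 0" unfolding s'_def t'_def by algebra
    with indep show False by simp
  qed
  \<comment> \<open>The coordinates of the rescaled component 1 become \<open>u\<close> and
    \<open>e1\<close>.\<close>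
  obtain x' y' where xy': "- (\<sigma> / x) * xa 1 + - (\<tau> / x) * ya 1 = x' * a1 + y' * b1"
    "- (\<sigma> / x) * xb 1 + - (\<tau> / x) * yb 1 = x' * a2 + y' * b2"
    using linear_2x2_solution[OF det] by metis
  show thesis
  proof (rule that[OF det _ _ v _ _ _ _ xy'])
    show "- (\<sigma> / x) * xa 0 + - (\<tau> / x) * ya 0 = - \<beta> / x * b1"
      "- (\<sigma> / x) * xb 0 + - (\<tau> / x) * yb 0 = - \<beta> / x * b2"
      using \<beta> \<open>x \<noteq> 0\<close> by (simp_all add: field_simps) (algebra+)?
    show "- (\<sigma> / x) * xa 2 + - (\<tau> / x) * ya 2 = - a1 + - y / x * b1"
      "- (\<sigma> / x) * xb 2 + - (\<tau> / x) * yb 2 = - a2 + - y / x * b2"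
      using xy \<open>x \<noteq> 0\<close> by (simp_all add: field_simps) (algebra+)?
  qed (simp_all add: ab)
qed

section \<open>Multihomogeneous polynomials\<close>

text \<open>
  Unfold this explicitly: as a simp rule it loops, because arithmetic on the type \<open>6\<close> refers to
  the cardinality of its universe.
\<close>
lemma UNIV_6: "(UNIV :: 6 set) = {0,1,2,3,4,5}"
  by (rule card_subset_eq[symmetric]) simp_all

lemma add_3_wraparound: "(6 :: 6) = 0" "(7 :: 6) = 1" "(8 :: 6) = 2"
  by simp_all

lemma sum_6: "(\<Sum>i\<in>(UNIV :: 6 set). f i) = f 0 + f 1 + f 2 + f 3 + f 4 + f 5"
  unfolding UNIV_6 by (simp add: add.assoc)

lemma multihomogeneous_const: "multihomogeneous (\<lambda>_. 0) (\<lambda>_. c)"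
  by (simp add: multihomogeneous_def poly_fun.const)

lemma multihomogeneous_coord: "multihomogeneous (\<lambda>j. of_bool (j = k)) (\<lambda>\<omega>. \<omega> k $ p)"
proof -
  have "(\<Prod>j\<in>UNIV. c j ^ of_bool (j = k)) = c k" for c :: "5 \<Rightarrow> complex"
  proof -
    have "(\<Prod>j\<in>UNIV. c j ^ of_bool (j = k)) = (\<Prod>j\<in>UNIV. if j = k then c j else 1)"
      by (rule prod.cong) auto
    then show ?thesis by simp
  qed
  then show ?thesis by (simp add: multihomogeneous_def poly_fun.coord)
qed

lemma multihomogeneous_mult:
  assumes "multihomogeneous d f" "multihomogeneous e g"
  shows "multihomogeneous (\<lambda>k. d k + e k) (\<lambda>\<omega>. f \<omega> * g \<omega>)"
  using assms by (simp add: multihomogeneous_def poly_fun.mult power_add prod.distrib mult_ac)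

lemma multihomogeneous_add:
  assumes "multihomogeneous d f" "multihomogeneous d g"
  shows "multihomogeneous d (\<lambda>\<omega>. f \<omega> + g \<omega>)"
  using assms by (simp add: multihomogeneous_def poly_fun.add algebra_simps)

lemma multihomogeneous_cmult:
  "multihomogeneous d f \<Longrightarrow> multihomogeneous d (\<lambda>\<omega>. c * f \<omega>)"
  using multihomogeneous_mult[OF multihomogeneous_const] by simp

lemma multihomogeneous_diff:
  assumes "multihomogeneous d f" "multihomogeneous d g"
  shows "multihomogeneous d (\<lambda>\<omega>. f \<omega> - g \<omega>)"
  using multihomogeneous_add[OF assms(1) multihomogeneous_cmult[OF assms(2), of "-1"]] by simp

lemma multihomogeneous_sum:
  assumes "\<And>i. i \<in> S \<Longrightarrow> multihomogeneous d (f i)"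
  shows "multihomogeneous d (\<lambda>\<omega>. \<Sum>i\<in>S. f i \<omega>)"
  using assms
proof (induction S rule: infinite_finite_induct)
  case (insert i S)
  then show ?case by (simp add: multihomogeneous_add)
qed (simp_all add: multihomogeneous_def poly_fun.const)

lemma multihomogeneous_prod:
  assumes "\<And>i. i \<in> S \<Longrightarrow> multihomogeneous (d i) (f i)"
  shows "multihomogeneous (\<lambda>k. \<Sum>i\<in>S. d i k) (\<lambda>\<omega>. \<Prod>i\<in>S. f i \<omega>)"
  using assms
  by (induction S rule: infinite_finite_induct)
    (simp_all add: multihomogeneous_const multihomogeneous_mult)

text \<open>The degree may vary with the column, since every Leibniz term takes exactly one entry
  from each column.\<close>

lemma multihomogeneous_det:
  fixes A :: "(5 \<Rightarrow> tensor2) \<Rightarrow> complex^'n^'n"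
  assumes "\<And>i j. multihomogeneous (d j) (\<lambda>\<omega>. A \<omega> $ i $ j)"
  shows "multihomogeneous (\<lambda>k. \<Sum>j\<in>UNIV. d j k) (\<lambda>\<omega>. det (A \<omega>))"
  unfolding det_def
proof (intro multihomogeneous_sum multihomogeneous_cmult)
  fix p :: "'n \<Rightarrow> 'n" assume "p \<in> {p. p permutes UNIV}"
  then have "(\<Sum>j\<in>UNIV. d j k) = (\<Sum>i\<in>UNIV. d (p i) k)" for k
    using sum.permute[of p UNIV "\<lambda>j. d j k"] by (simp add: o_def)
  then show "multihomogeneous (\<lambda>k. \<Sum>j\<in>UNIV. d j k) (\<lambda>\<omega>. \<Prod>i\<in>UNIV. A \<omega> $ i $ p i)"
    using multihomogeneous_prod[of UNIV "\<lambda>i. d (p i)", OF assms] by simp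
qed

lemma multihomogeneous_2x2:
  assumes "multihomogeneous d f" "multihomogeneous d f'" "multihomogeneous e g" "multihomogeneous e g'"
  shows "multihomogeneous (\<lambda>k. d k + e k) (\<lambda>\<omega>. f \<omega> * g' \<omega> - f' \<omega> * g \<omega>)"
  using assms by (intro multihomogeneous_diff multihomogeneous_mult)

section \<open>Bases and lines\<close>

lemma basis6I:
  assumes "vec.span (range \<epsilon>) = UNIV"
  shows "basis6 \<epsilon>"
proof -
  have dim: "vec.dim (UNIV :: V6 set) = 6"
    by (subst vec_dim_card) simp
  have le: "card (range \<epsilon>) \<le> 6"
    using card_image_le[of "UNIV :: 6 set" \<epsilon>] by simp
  then have "vec.independent (range \<epsilon>)"
    using assms dim by (intro vec.card_le_dim_spanning[of _ UNIV]) auto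
  moreover have "6 \<le> card (range \<epsilon>)"
    using vec.dim_le_card[of UNIV "range \<epsilon>"] assms unfolding dim by simp
  then have "inj \<epsilon>"
    using le by (intro eq_card_imp_inj_on) auto
  ultimately show ?thesis using assms by (simp add: basis6_def)
qed

lemma basis6_sum_eq_0:
  assumes "basis6 \<epsilon>" "(\<Sum>i\<in>UNIV. c i *s \<epsilon> i) = 0"
  shows "c i = 0"
proof -
  have inj: "inj \<epsilon>" and ind: "vec.independent (range \<epsilon>)" using assms by (auto simp: basis6_def)
  have "(\<Sum>v\<in>range \<epsilon>. c (inv \<epsilon> v) *s v) = 0"
    using assms(2) inj by (simp add: sum.reindex)
  then have "c (inv \<epsilon> (\<epsilon> i)) = 0"
    using ind by (auto simp: vec.dependent_finite)
  then show ?thesis using inj by simp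
qed

lemma independent_pair:
  fixes x y :: V6
  assumes ind: "\<And>\<alpha> \<beta>. \<alpha> *s x + \<beta> *s y = 0 \<Longrightarrow> \<alpha> = 0 \<and> \<beta> = 0"
  shows "x \<noteq> y \<and> vec.independent {x, y}"
proof
  show ne: "x \<noteq> y" using ind[of 1 "-1"] by auto
  show "vec.independent {x, y}"
  proof (rule vec.independent_if_scalars_zero)
    fix f z assume "(\<Sum>v\<in>{x, y}. f v *s v) = 0" "z \<in> {x, y}"
    then show "f z = 0" using ne ind[of "f x" "f y"] by auto
  qed simp
qed

text \<open>Two independent vectors of a plane span it. The claims about the lines in the normal
  form thus reduce to membership and independence of two vectors.\<close>

lemma representsI:
  assumes L: "L \<in> G26" "x \<in> L" "y \<in> L"
    and ind: "\<And>\<alpha> \<beta>. \<alpha> *s x + \<beta> *s y = 0 \<Longrightarrow> \<alpha> = 0 \<and> \<beta> = 0"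
  shows "represents (x \<and>\<and> y) L"
proof -
  have ne: "x \<noteq> y" and i: "vec.independent {x, y}"
    using independent_pair[OF ind] by blast+
  have "vec.subspace L" "vec.dim L = 2" using L by (auto simp: G26_def)
  then have "L \<subseteq> vec.span {x, y}"
    using L i ne by (intro vec.card_ge_dim_independent) auto
  then have "vec.span {x, y} = L"
    using L vec.span_minimal[OF _ \<open>vec.subspace L\<close>, of "{x, y}"] by blast
  then show ?thesis
    unfolding represents_def using ne i by (intro exI[of _ x] exI[of _ y] exI[of _ 1]) simp
qed

lemma span_pair_in_G26:
  assumes "\<And>\<alpha> \<beta>. \<alpha> *s x + \<beta> *s y = 0 \<Longrightarrow> \<alpha> = 0 \<and> \<beta> = 0"
  shows "vec.span {x, y} \<in> G26 \<and> represents (x \<and>\<and> y) (vec.span {x, y})"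
proof -
  have "vec.span {x, y} \<in> G26"
    using independent_pair[OF assms] vec.dim_span_eq_card_independent[of "{x, y}"] by (simp add: G26_def)
  then show ?thesis using assms by (auto intro!: representsI vec.span_base)
qed

text \<open>
  The contractions of a decomposable tensor with the coordinate forms are vectors of the line that
  it represents, with coordinates linear in the tensor.
\<close>
definition right_contraction :: "6 \<Rightarrow> tensor2 \<Rightarrow> V6" where
  "right_contraction r \<omega> = (\<chi> i. \<omega> $ (i, r))"

definition left_contraction :: "6 \<Rightarrow> tensor2 \<Rightarrow> V6" where
  "left_contraction r \<omega> = (\<chi> i. \<omega> $ (r, i))"

lemma contractions_in_line:
  assumes "represents \<omega> L"
  shows "right_contraction r \<omega> \<in> L" "left_contraction r \<omega> \<in> L"
proof -
  obtain x y c where L: "L = vec.span {x, y}" and \<omega>: "\<omega> = c *s (x \<and>\<and> y)"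
    using assms by (auto simp: represents_def)
  have mem: "\<alpha> *s x + \<beta> *s y \<in> L" for \<alpha> \<beta>
    unfolding L by (intro vec.span_add vec.span_scale vec.span_base) auto
  have "right_contraction r \<omega> = (c * y $ r) *s x + (- c * x $ r) *s y"
    "left_contraction r \<omega> = (- c * y $ r) *s x + (c * x $ r) *s y"
    by (simp_all add: right_contraction_def left_contraction_def \<omega> wedge_def vec_eq_iff algebra_simps)
  then show "right_contraction r \<omega> \<in> L" "left_contraction r \<omega> \<in> L" using mem by metis+
qed

section \<open>The normal form in a frame\<close>

text \<open>
  In a basis \<open>e\<close>, the components at \<open>i\<close> and \<open>i + 3\<close> of a vector form its projection to the plane
  spanned by \<open>e i\<close> and \<open>e (i + 3)\<close>.  By Cramer's rule the coordinates of this projection with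
  respect to the projections of \<open>P\<close> and \<open>Q\<close> are \<open>minor V Q i\<close> and \<open>minor P V i\<close>, up to the common
  factor \<open>minor P Q i\<close>.  The bracket is the polarised determinant of two such coordinate pairs.
\<close>
definition minor :: "(6 \<Rightarrow> complex) \<Rightarrow> (6 \<Rightarrow> complex) \<Rightarrow> 6 \<Rightarrow> complex" where
  "minor P Q i = P i * Q (i + 3) - P (i + 3) * Q i"

definition pencil_bracket ::
    "(6 \<Rightarrow> complex) \<Rightarrow> (6 \<Rightarrow> complex) \<Rightarrow> 6 \<Rightarrow> 6 \<Rightarrow> (6 \<Rightarrow> complex) \<Rightarrow> (6 \<Rightarrow> complex) \<Rightarrow> complex" where
  "pencil_bracket P Q i j V W = minor V Q i * minor P W j - minor P V i * minor W Q j"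

text \<open>The arguments are the coefficients in \<open>s\<close> and \<open>t\<close> of the forms
  \<open>det (M\<^sub>1 z, M\<^sub>2 z)\<close> and \<open>det (M\<^sub>0 z, M\<^sub>2 z)\<close>
  for \<open>z = s X + t Y\<close>, after clearing the denominators
  \<open>minor P Q i * minor P Q j\<close>.\<close>

definition pencil_resultant ::
    "(6 \<Rightarrow> complex) \<Rightarrow> (6 \<Rightarrow> complex) \<Rightarrow> (6 \<Rightarrow> complex) \<Rightarrow> (6 \<Rightarrow> complex) \<Rightarrow> complex" where
  "pencil_resultant P Q X Y = quad_resultant
    (pencil_bracket P Q 1 2 X X)
    (pencil_bracket P Q 1 2 X Y + pencil_bracket P Q 1 2 Y X)
    (pencil_bracket P Q 1 2 Y Y)
    (pencil_bracket P Q 0 2 X X)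
    (pencil_bracket P Q 0 2 X Y + pencil_bracket P Q 0 2 Y X)
    (pencil_bracket P Q 0 2 Y Y)"

lemma frame_normal_form:
  fixes e :: "6 \<Rightarrow> V6" and P Q X Y :: "6 \<Rightarrow> complex"
  defines "vector_of \<equiv> \<lambda>c. \<Sum>i\<in>UNIV. c i *s e i"
  assumes span: "vec.span (range e) = UNIV"
    and minor: "minor P Q 0 \<noteq> 0" "minor P Q 1 \<noteq> 0" "minor P Q 2 \<noteq> 0"
    and res: "pencil_resultant P Q X Y \<noteq> 0"
  obtains \<epsilon> u v a e1 e2 where "basis6 \<epsilon>"
    "\<epsilon> 0 \<in> vec.span {e 0, e 3}" "\<epsilon> 3 \<in> vec.span {e 0, e 3}"
    "\<epsilon> 1 \<in> vec.span {e 1, e 4}" "\<epsilon> 4 \<in> vec.span {e 1, e 4}"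
    "\<epsilon> 2 \<in> vec.span {e 2, e 5}" "\<epsilon> 5 \<in> vec.span {e 2, e 5}"
    "\<epsilon> 0 + \<epsilon> 1 + \<epsilon> 2 \<in> vec.span {vector_of P, vector_of Q}"
    "\<epsilon> 3 + \<epsilon> 4 + \<epsilon> 5 \<in> vec.span {vector_of P, vector_of Q}"
    "- \<epsilon> 0 + v *s \<epsilon> 4 - \<epsilon> 5 \<in> vec.span {vector_of X, vector_of Y}"
    "u *s \<epsilon> 1 - \<epsilon> 2 + a *s \<epsilon> 3 + e1 *s \<epsilon> 4 + e2 *s \<epsilon> 5 \<in> vec.span {vector_of X, vector_of Y}"
proof -
  have comb: "\<alpha> *s x + \<beta> *s y \<in> vec.span {x, y}" for \<alpha> \<beta> and x y :: V6
    by (intro vec.span_add vec.span_scale vec.span_base) auto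
  \<comment> \<open>These are the matrix entries of \<open>M\<^sub>i\<close> with respect to
    \<open>X\<close>, \<open>Y\<close> and \<open>P\<close>, \<open>Q\<close>.\<close>
  define xa xb ya yb where
    "xa i = minor X Q i / minor P Q i" and "xb i = minor P X i / minor P Q i" and
    "ya i = minor Y Q i / minor P Q i" and "yb i = minor P Y i / minor P Q i" for i
  define q where "q i j s t = (s * xa i + t * ya i) * (s * xb j + t * yb j)
                        - (s * xb i + t * yb i) * (s * xa j + t * ya j)" for i j s t
  have q: "q i j s t * minor P Q i * minor P Q j = pencil_bracket P Q i j X X * s\<^sup>2
      + (pencil_bracket P Q i j X Y + pencil_bracket P Q i j Y X) * s * t + pencil_bracket P Q i j Y Y * t\<^sup>2"
    if nz: "minor P Q i \<noteq> 0" "minor P Q j \<noteq> 0" for i j s t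
  proof -
    have "q i j s t * minor P Q i * minor P Q j =
        (s * (xa i * minor P Q i) + t * (ya i * minor P Q i)) * (s * (xb j * minor P Q j) + t * (yb j * minor P Q j))
      - (s * (xb i * minor P Q i) + t * (yb i * minor P Q i)) * (s * (xa j * minor P Q j) + t * (ya j * minor P Q j))"
      unfolding q_def by algebra
    also have "\<dots> = (s * minor X Q i + t * minor Y Q i) * (s * minor P X j + t * minor P Y j)
      - (s * minor P X i + t * minor P Y i) * (s * minor X Q j + t * minor Y Q j)"
      using nz by (simp add: xa_def xb_def ya_def yb_def)
    also have "\<dots> = pencil_bracket P Q i j X X * s\<^sup>2
      + (pencil_bracket P Q i j X Y + pencil_bracket P Q i j Y X) * s * t + pencil_bracket P Q i j Y Y * t\<^sup>2"
      unfolding pencil_bracket_def by algebra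
    finally show ?thesis .
  qed
  have no_common_root: "s = 0 \<and> t = 0" if "q 1 2 s t = 0" "q 0 2 s t = 0" for s t
    using q[of 1 2 s t] q[of 0 2 s t] minor that
    by (intro quad_resultant_common_root[OF res[unfolded pencil_resultant_def]]) simp_all
  obtain s t s' t' a1 a2 b1 b2 u v \<alpha> e1 e2 where
    det: "a1 * b2 - a2 * b1 \<noteq> 0" and
    z: "s * xa 0 + t * ya 0 = - a1" "s * xb 0 + t * yb 0 = - a2"
    "s * xa 1 + t * ya 1 = v * b1" "s * xb 1 + t * yb 1 = v * b2"
    "s * xa 2 + t * ya 2 = - b1" "s * xb 2 + t * yb 2 = - b2" and
    w: "s' * xa 0 + t' * ya 0 = \<alpha> * b1" "s' * xb 0 + t' * yb 0 = \<alpha> * b2"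
    "s' * xa 1 + t' * ya 1 = u * a1 + e1 * b1" "s' * xb 1 + t' * yb 1 = u * a2 + e1 * b2"
    "s' * xa 2 + t' * ya 2 = - a1 + e2 * b1" "s' * xb 2 + t' * yb 2 = - a2 + e2 * b2"
    by (rule pencil_normal_form[OF q_def no_common_root])
  define A B where "A i = P i *s e i + P (i + 3) *s e (i + 3)"
    and "B i = Q i *s e i + Q (i + 3) *s e (i + 3)" for i
  \<comment> \<open>The same \<open>a\<close> and \<open>b\<close> are copied into all three planes,
    so the sums over the copies lie in the fourth line. In the second branch \<open>i + 3\<close>
    wraps from 3, 4, 5 to 0, 1, 2.\<close>
  define \<epsilon> where "\<epsilon> i = (if i \<in> {0, 1, 2} then a1 *s A i + a2 *s B i
                            else b1 *s A (i + 3) + b2 *s B (i + 3))" for i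
  have \<epsilon>: "\<epsilon> 0 = a1 *s A 0 + a2 *s B 0" "\<epsilon> 1 = a1 *s A 1 + a2 *s B 1" "\<epsilon> 2 = a1 *s A 2 + a2 *s B 2"
    "\<epsilon> 3 = b1 *s A 0 + b2 *s B 0" "\<epsilon> 4 = b1 *s A 1 + b2 *s B 1" "\<epsilon> 5 = b1 *s A 2 + b2 *s B 2"
    by (simp_all add: \<epsilon>_def add_3_wraparound)
  have PQ: "vector_of P = A 0 + A 1 + A 2" "vector_of Q = B 0 + B 1 + B 2"
    by (simp_all add: vector_of_def sum_6 A_def B_def vec_eq_iff)
  have coord: "V i *s e i + V (i + 3) *s e (i + 3)
      = (minor V Q i / minor P Q i) *s A i + (minor P V i / minor P Q i) *s B i"
    if "minor P Q i \<noteq> 0" for V i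
  proof -
    define k l where "k = minor V Q i / minor P Q i" and "l = minor P V i / minor P Q i"
    have V: "V i = k * P i + l * Q i" "V (i + 3) = k * P (i + 3) + l * Q (i + 3)"
      using that unfolding k_def l_def by (simp_all add: divide_simps) (simp_all add: minor_def algebra_simps)
    show ?thesis
      unfolding V k_def[symmetric] l_def[symmetric] by (simp add: A_def B_def vec_eq_iff algebra_simps)
  qed
  have decomp: "vector_of V = (minor V Q 0 / minor P Q 0) *s A 0 + (minor P V 0 / minor P Q 0) *s B 0
      + ((minor V Q 1 / minor P Q 1) *s A 1 + (minor P V 1 / minor P Q 1) *s B 1)
      + ((minor V Q 2 / minor P Q 2) *s A 2 + (minor P V 2 / minor P Q 2) *s B 2)" for V
    unfolding coord[OF minor(1), symmetric] coord[OF minor(2), symmetric] coord[OF minor(3), symmetric]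
    by (simp add: vector_of_def sum_6 add_ac)
  have XY: "\<sigma> *s vector_of X + \<tau> *s vector_of Y =
      (\<sigma> * xa 0 + \<tau> * ya 0) *s A 0 + (\<sigma> * xb 0 + \<tau> * yb 0) *s B 0
      + ((\<sigma> * xa 1 + \<tau> * ya 1) *s A 1 + (\<sigma> * xb 1 + \<tau> * yb 1) *s B 1)
      + ((\<sigma> * xa 2 + \<tau> * ya 2) *s A 2 + (\<sigma> * xb 2 + \<tau> * yb 2) *s B 2)" for \<sigma> \<tau>
    unfolding decomp[of X, folded xa_def xb_def] decomp[of Y, folded ya_def yb_def]
    by (simp add: vec_eq_iff algebra_simps)
  have AB: "A i \<in> vec.span {e i, e (i + 3)}" "B i \<in> vec.span {e i, e (i + 3)}" for i
    unfolding A_def B_def by (rule comb)+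
  have \<epsilon>_in: "\<alpha> *s A i + \<beta> *s B i \<in> vec.span {e i, e (i + 3)}" for \<alpha> \<beta> i
    by (intro vec.span_add vec.span_scale AB)
  show thesis
  proof (rule that)
    show "\<epsilon> 0 \<in> vec.span {e 0, e 3}" "\<epsilon> 3 \<in> vec.span {e 0, e 3}"
      using \<epsilon>_in[of _ 0] by (simp_all add: \<epsilon>)
    show "\<epsilon> 1 \<in> vec.span {e 1, e 4}" "\<epsilon> 4 \<in> vec.span {e 1, e 4}"
      using \<epsilon>_in[of _ 1] by (simp_all add: \<epsilon>)
    show "\<epsilon> 2 \<in> vec.span {e 2, e 5}" "\<epsilon> 5 \<in> vec.span {e 2, e 5}"
      using \<epsilon>_in[of _ 2] by (simp_all add: \<epsilon>)
    have "\<epsilon> 0 + \<epsilon> 1 + \<epsilon> 2 = a1 *s vector_of P + a2 *s vector_of Q"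
      "\<epsilon> 3 + \<epsilon> 4 + \<epsilon> 5 = b1 *s vector_of P + b2 *s vector_of Q"
      by (simp_all add: PQ \<epsilon> vec_eq_iff algebra_simps)
    then show "\<epsilon> 0 + \<epsilon> 1 + \<epsilon> 2 \<in> vec.span {vector_of P, vector_of Q}"
      "\<epsilon> 3 + \<epsilon> 4 + \<epsilon> 5 \<in> vec.span {vector_of P, vector_of Q}"
      using comb by simp_all
    have "- \<epsilon> 0 + v *s \<epsilon> 4 - \<epsilon> 5 = s *s vector_of X + t *s vector_of Y"
      unfolding XY z by (simp add: \<epsilon> vec_eq_iff algebra_simps)
    then show "- \<epsilon> 0 + v *s \<epsilon> 4 - \<epsilon> 5 \<in> vec.span {vector_of X, vector_of Y}"
      using comb by simp
    have "u *s \<epsilon> 1 - \<epsilon> 2 + \<alpha> *s \<epsilon> 3 + e1 *s \<epsilon> 4 + e2 *s \<epsilon> 5 = s' *s vector_of X + t' *s vector_of Y"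
      unfolding XY w by (simp add: \<epsilon> vec_eq_iff algebra_simps)
    then show "u *s \<epsilon> 1 - \<epsilon> 2 + \<alpha> *s \<epsilon> 3 + e1 *s \<epsilon> 4 + e2 *s \<epsilon> 5
        \<in> vec.span {vector_of X, vector_of Y}"
      using comb by simp
    \<comment> \<open>Inversion of a 2 by 2 system, used twice: from \<open>\<epsilon>\<close> back
      to \<open>A\<close> and \<open>B\<close>, then from these back to \<open>e\<close>.\<close>
    have invert: "x \<in> vec.span (range \<epsilon>) \<and> y \<in> vec.span (range \<epsilon>)"
      if "c1 *s x + c2 *s y \<in> vec.span (range \<epsilon>)" "d1 *s x + d2 *s y \<in> vec.span (range \<epsilon>)"
        "c1 * d2 - c2 * d1 \<noteq> 0" for c1 c2 d1 d2 x y
    proof -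
      have "x = (1 / (c1 * d2 - c2 * d1)) *s (d2 *s (c1 *s x + c2 *s y) - c2 *s (d1 *s x + d2 *s y))"
        "y = (1 / (c1 * d2 - c2 * d1)) *s (c1 *s (d1 *s x + d2 *s y) - d1 *s (c1 *s x + c2 *s y))"
        using that(3) by (simp_all add: vec_eq_iff divide_simps) (simp_all add: algebra_simps)
      then show ?thesis
        using that(1,2) by (metis vec.span_diff vec.span_scale)
    qed
    have e: "e i \<in> vec.span (range \<epsilon>) \<and> e (i + 3) \<in> vec.span (range \<epsilon>)"
      if "minor P Q i \<noteq> 0" "\<epsilon> i = a1 *s A i + a2 *s B i" "\<epsilon> (i + 3) = b1 *s A i + b2 *s B i" for i
    proof -
      have "A i \<in> vec.span (range \<epsilon>) \<and> B i \<in> vec.span (range \<epsilon>)"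
        using that(2,3) det by (intro invert[of a1 _ a2 _ b1 b2]) (metis rangeI vec.span_base)+
      then show ?thesis
        using that(1) by (intro invert[of "P i" _ "P (i + 3)" _ "Q i" "Q (i + 3)"])
          (auto simp: A_def B_def minor_def)
    qed
    have "e ` {0, 1, 2, 3, 4, 5} \<subseteq> vec.span (range \<epsilon>)"
      using e[of 0] e[of 1] e[of 2] minor by (simp add: \<epsilon>)
    then have "range e \<subseteq> vec.span (range \<epsilon>)"
      by (simp only: UNIV_6[symmetric])
    then have "vec.span (range \<epsilon>) = UNIV"
      using span vec.span_minimal[OF _ vec.subspace_span] by blast
    then show "basis6 \<epsilon>" by (rule basis6I)
  qed
qed

section \<open>The general position polynomial\<close>

definition line_of :: "6 \<Rightarrow> 5" where
  "line_of i = (if i \<in> {0, 3} then 0 else if i \<in> {1, 4} then 1 else 2)"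

text \<open>The index \<open>i + 3\<close> is taken modulo 6, so it also leads from 3, 4, 5 back to 0, 1, 2.\<close>
definition frame :: "(5 \<Rightarrow> tensor2) \<Rightarrow> 6 \<Rightarrow> V6" where
  "frame \<omega> i = (if i \<in> {0, 1, 2} then right_contraction (i + 3) (\<omega> (line_of i))
                  else left_contraction (i + 3) (\<omega> (line_of i)))"

definition frame_matrix :: "(5 \<Rightarrow> tensor2) \<Rightarrow> complex^6^6" where
  "frame_matrix \<omega> = (\<chi> r j. frame \<omega> j $ r)"

text \<open>These are the numerators in Cramer's rule. Without the division by the determinant the
  coordinates stay polynomial, at the price of a common factor.\<close>

definition frame_coord :: "(5 \<Rightarrow> tensor2) \<Rightarrow> V6 \<Rightarrow> 6 \<Rightarrow> complex" where
  "frame_coord \<omega> v i = det (\<chi> r j. if j = i then v $ r else frame_matrix \<omega> $ r $ j)"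

lemma frame_coord_sum:
  assumes "det (frame_matrix \<omega>) \<noteq> 0"
  shows "(\<Sum>i\<in>UNIV. frame_coord \<omega> v i *s frame \<omega> i) = det (frame_matrix \<omega>) *s v"
proof -
  have col: "column i (frame_matrix \<omega>) = frame \<omega> i" for i
    by (simp add: column_def frame_matrix_def vec_eq_iff)
  have "frame_matrix \<omega> *v (\<chi> k. frame_coord \<omega> v k / det (frame_matrix \<omega>)) = v"
    using cramer[OF assms] unfolding frame_coord_def by blast
  then have "v = (\<Sum>i\<in>UNIV. (frame_coord \<omega> v i / det (frame_matrix \<omega>)) *s frame \<omega> i)"
    by (simp add: matrix_mult_sum col)
  then have "det (frame_matrix \<omega>) *s v
      = det (frame_matrix \<omega>) *s (\<Sum>i\<in>UNIV. (frame_coord \<omega> v i / det (frame_matrix \<omega>)) *s frame \<omega> i)"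
    by simp
  also have "\<dots> = (\<Sum>i\<in>UNIV. frame_coord \<omega> v i *s frame \<omega> i)"
    using assms by (simp add: vec.scale_sum_right)
  finally show ?thesis by simp
qed

lemma span_frame:
  assumes "det (frame_matrix \<omega>) \<noteq> 0"
  shows "vec.span (range (frame \<omega>)) = UNIV"
proof -
  have "v \<in> vec.span (range (frame \<omega>))" for v
  proof -
    have "v = (1 / det (frame_matrix \<omega>)) *s (\<Sum>i\<in>UNIV. frame_coord \<omega> v i *s frame \<omega> i)"
      using assms by (simp add: frame_coord_sum)
    moreover have "\<dots> \<in> vec.span (range (frame \<omega>))"
      by (intro vec.span_scale vec.span_sum vec.span_base) auto
    ultimately show ?thesis by simp
  qed
  then show ?thesis by auto
qed

lemma multihomogeneous_frame:
  "multihomogeneous (\<lambda>k. of_bool (k = line_of i)) (\<lambda>\<omega>. frame \<omega> i $ r)"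
  by (cases "i \<in> {0, 1, 2}")
    (simp_all add: frame_def right_contraction_def left_contraction_def multihomogeneous_coord del: insert_iff)

lemma multihomogeneous_det_frame:
  "multihomogeneous (\<lambda>k. \<Sum>j\<in>UNIV. of_bool (k = line_of j)) (\<lambda>\<omega>. det (frame_matrix \<omega>))"
  by (rule multihomogeneous_det) (simp add: frame_matrix_def multihomogeneous_frame)

definition coord_degree :: "6 \<Rightarrow> 5 \<Rightarrow> nat" where
  "coord_degree i k = (\<Sum>j\<in>UNIV - {i}. of_bool (k = line_of j))"

text \<open>The columns \<open>i\<close> and \<open>i + 3\<close> come from the same line. Hence
  both products in \<open>minor\<close> have the same multidegree.\<close>

lemma coord_degree_opposite: "i \<in> {0, 1, 2} \<Longrightarrow> coord_degree (i + 3) k = coord_degree i k"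
  by (auto simp: coord_degree_def sum_diff1_nat line_of_def)

lemma multihomogeneous_frame_coord:
  assumes "\<And>r. multihomogeneous d (\<lambda>\<omega>. v \<omega> $ r)"
  shows "multihomogeneous (\<lambda>k. coord_degree i k + d k) (\<lambda>\<omega>. frame_coord \<omega> (v \<omega>) i)"
proof -
  have "multihomogeneous (\<lambda>k. \<Sum>j\<in>UNIV. (if j = i then d else (\<lambda>k. of_bool (k = line_of j))) k)
     (\<lambda>\<omega>. frame_coord \<omega> (v \<omega>) i)"
    unfolding frame_coord_def
    by (rule multihomogeneous_det) (simp add: frame_matrix_def multihomogeneous_frame assms)
  moreover have "(\<Sum>j\<in>UNIV. (if j = i then d else (\<lambda>k. of_bool (k = line_of j))) k) = coord_degree i k + d k" for k
  proof -
    have "(\<Sum>j\<in>UNIV. (if j = i then d else (\<lambda>k. of_bool (k = line_of j))) k)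
      = d k + (\<Sum>j\<in>UNIV - {i}. (if j = i then d else (\<lambda>k. of_bool (k = line_of j))) k)"
      by (subst sum.remove[of UNIV i]) auto
    also have "\<dots> = d k + coord_degree i k"
      unfolding coord_degree_def by (intro arg_cong2[of _ _ _ _ "(+)"] sum.cong) auto
    finally show ?thesis by simp
  qed
  ultimately show ?thesis by simp
qed

lemma multihomogeneous_minor:
  assumes "\<And>r. multihomogeneous d (\<lambda>\<omega>. v \<omega> $ r)" "\<And>r. multihomogeneous e (\<lambda>\<omega>. w \<omega> $ r)"
    and i: "i \<in> {0, 1, 2}"
  shows "multihomogeneous (\<lambda>k. 2 * coord_degree i k + (d k + e k))
    (\<lambda>\<omega>. minor (frame_coord \<omega> (v \<omega>)) (frame_coord \<omega> (w \<omega>)) i)"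
proof -
  have "multihomogeneous (\<lambda>k. (coord_degree i k + d k) + (coord_degree i k + e k))
    (\<lambda>\<omega>. minor (frame_coord \<omega> (v \<omega>)) (frame_coord \<omega> (w \<omega>)) i)"
    unfolding minor_def
    by (intro multihomogeneous_2x2 multihomogeneous_frame_coord assms
      multihomogeneous_frame_coord[of _ _ "i + 3", unfolded coord_degree_opposite[OF i]])
  then show ?thesis by (simp add: algebra_simps mult_2)
qed

lemma multihomogeneous_quad_resultant:
  assumes "multihomogeneous d a" "multihomogeneous d b" "multihomogeneous d c"
    and "multihomogeneous e a'" "multihomogeneous e b'" "multihomogeneous e c'"
  shows "multihomogeneous (\<lambda>k. d k + e k + (d k + e k))
    (\<lambda>\<omega>. quad_resultant (a \<omega>) (b \<omega>) (c \<omega>) (a' \<omega>) (b' \<omega>) (c' \<omega>))"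
  unfolding quad_resultant_def
  by (intro multihomogeneous_2x2 multihomogeneous_diff[OF multihomogeneous_mult multihomogeneous_mult] assms)

text \<open>The determinant expresses that the first three planes are complementary, the minors that
  the fourth projects isomorphically to each of them, and the resultant that the two quadratic forms
  have no common root. The contractions with the forms 3 and 0 span a line exactly when the
  \<open>(0, 3)\<close> entry of its tensor is nonzero, so the indices only select a smaller open
  set.\<close>

definition general_position_poly :: "(5 \<Rightarrow> tensor2) \<Rightarrow> complex" where
  "general_position_poly \<omega> =
    (let P = frame_coord \<omega> (right_contraction 3 (\<omega> 3)); Q = frame_coord \<omega> (left_contraction 0 (\<omega> 3));
         X = frame_coord \<omega> (right_contraction 3 (\<omega> 4)); Y = frame_coord \<omega> (left_contraction 0 (\<omega> 4))
     in det (frame_matrix \<omega>) * minor P Q 0 * minor P Q 1 * minor P Q 2 * pencil_resultant P Q X Y)"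

lemma multihomogeneous_general_position: "\<exists>d. multihomogeneous d general_position_poly"
proof -
  have contr: "multihomogeneous (\<lambda>j. of_bool (j = k)) (\<lambda>\<omega>. right_contraction s (\<omega> k) $ r)"
    "multihomogeneous (\<lambda>j. of_bool (j = k)) (\<lambda>\<omega>. left_contraction s (\<omega> k) $ r)" for k s r
    by (simp_all add: right_contraction_def left_contraction_def multihomogeneous_coord)
  define \<delta> :: "5 \<Rightarrow> 5 \<Rightarrow> nat" where "\<delta> k = (\<lambda>j. of_bool (j = k))" for k
  define p q x y :: "(5 \<Rightarrow> tensor2) \<Rightarrow> V6" where
    "p \<omega> = right_contraction 3 (\<omega> 3)" and "q \<omega> = left_contraction 0 (\<omega> 3)" and
    "x \<omega> = right_contraction 3 (\<omega> 4)" and "y \<omega> = left_contraction 0 (\<omega> 4)" for \<omega>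
  have deg: "multihomogeneous (\<delta> 3) (\<lambda>\<omega>. p \<omega> $ r)" "multihomogeneous (\<delta> 3) (\<lambda>\<omega>. q \<omega> $ r)"
    "multihomogeneous (\<delta> 4) (\<lambda>\<omega>. x \<omega> $ r)" "multihomogeneous (\<delta> 4) (\<lambda>\<omega>. y \<omega> $ r)" for r
    unfolding \<delta>_def p_def q_def x_def y_def by (rule contr)+
  define E where "E i j k = 2 * coord_degree i k + (\<delta> 4 k + \<delta> 3 k) + (2 * coord_degree j k + (\<delta> 3 k + \<delta> 4 k))"
    for i j k
  have bracket: "multihomogeneous (E i j)
    (\<lambda>\<omega>. pencil_bracket (frame_coord \<omega> (p \<omega>)) (frame_coord \<omega> (q \<omega>)) i j (frame_coord \<omega> (v \<omega>)) (frame_coord \<omega> (w \<omega>)))"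
    if "i \<in> {0, 1, 2}" "j \<in> {0, 1, 2}"
      and vw: "\<And>r. multihomogeneous (\<delta> 4) (\<lambda>\<omega>. v \<omega> $ r)" "\<And>r. multihomogeneous (\<delta> 4) (\<lambda>\<omega>. w \<omega> $ r)"
    for i j v w
    unfolding pencil_bracket_def E_def
    using multihomogeneous_minor[OF vw(1) deg(2) that(1)] multihomogeneous_minor[OF deg(1) vw(1) that(1)]
      multihomogeneous_minor[OF vw(2) deg(2) that(2)] multihomogeneous_minor[OF deg(1) vw(2) that(2)]
    by (intro multihomogeneous_2x2) (simp_all add: add_ac)
  have resultant: "multihomogeneous (\<lambda>k. E 1 2 k + E 0 2 k + (E 1 2 k + E 0 2 k))
    (\<lambda>\<omega>. pencil_resultant (frame_coord \<omega> (p \<omega>)) (frame_coord \<omega> (q \<omega>))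
      (frame_coord \<omega> (x \<omega>)) (frame_coord \<omega> (y \<omega>)))"
    unfolding pencil_resultant_def
    by (intro multihomogeneous_quad_resultant multihomogeneous_add bracket deg) simp_all
  have minor_pq: "multihomogeneous (\<lambda>k. 2 * coord_degree i k + (\<delta> 3 k + \<delta> 3 k))
    (\<lambda>\<omega>. minor (frame_coord \<omega> (p \<omega>)) (frame_coord \<omega> (q \<omega>)) i)" if "i \<in> {0, 1, 2}" for i
    using multihomogeneous_minor[OF deg(1,2) that] .
  have "general_position_poly = (\<lambda>\<omega>. det (frame_matrix \<omega>)
     * minor (frame_coord \<omega> (p \<omega>)) (frame_coord \<omega> (q \<omega>)) 0
     * minor (frame_coord \<omega> (p \<omega>)) (frame_coord \<omega> (q \<omega>)) 1
     * minor (frame_coord \<omega> (p \<omega>)) (frame_coord \<omega> (q \<omega>)) 2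
     * pencil_resultant (frame_coord \<omega> (p \<omega>)) (frame_coord \<omega> (q \<omega>))
        (frame_coord \<omega> (x \<omega>)) (frame_coord \<omega> (y \<omega>)))"
    by (simp add: general_position_poly_def p_def q_def x_def y_def Let_def fun_eq_iff)
  moreover have "\<exists>d. multihomogeneous d \<dots>"
    using multihomogeneous_mult[OF multihomogeneous_mult[OF multihomogeneous_mult[OF
      multihomogeneous_mult[OF multihomogeneous_det_frame minor_pq[of 0]] minor_pq[of 1]] minor_pq[of 2]] resultant]
    by auto
  ultimately show ?thesis by simp
qed

lemma normal_form_of_general_position:
  assumes lines: "L \<in> G26_pow5" "\<forall>k. represents (\<omega> k) (L k)"
    and gp: "general_position_poly \<omega> \<noteq> 0"
  obtains \<epsilon> u v a e1 e2 where "basis6 \<epsilon>"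
    "represents (\<epsilon> 0 \<and>\<and> \<epsilon> 3) (L 0)" "represents (\<epsilon> 1 \<and>\<and> \<epsilon> 4) (L 1)" "represents (\<epsilon> 2 \<and>\<and> \<epsilon> 5) (L 2)"
    "represents ((\<epsilon> 0 + \<epsilon> 1 + \<epsilon> 2) \<and>\<and> (\<epsilon> 3 + \<epsilon> 4 + \<epsilon> 5)) (L 3)"
    "represents ((- \<epsilon> 0 + v *s \<epsilon> 4 - \<epsilon> 5) \<and>\<and>
      (u *s \<epsilon> 1 - \<epsilon> 2 + a *s \<epsilon> 3 + e1 *s \<epsilon> 4 + e2 *s \<epsilon> 5)) (L 4)"
proof -
  have L: "L k \<in> G26" and rep: "represents (\<omega> k) (L k)" for k
    using lines by (simp_all add: G26_pow5_def)
  define e D where "e = frame \<omega>" and "D = det (frame_matrix \<omega>)"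
  define p q x y where "p = right_contraction 3 (\<omega> 3)" and "q = left_contraction 0 (\<omega> 3)"
    and "x = right_contraction 3 (\<omega> 4)" and "y = left_contraction 0 (\<omega> 4)"
  let ?P = "frame_coord \<omega> p" and ?Q = "frame_coord \<omega> q" and ?X = "frame_coord \<omega> x" and ?Y = "frame_coord \<omega> y"
  have D: "D \<noteq> 0" and minor: "minor ?P ?Q 0 \<noteq> 0" "minor ?P ?Q 1 \<noteq> 0" "minor ?P ?Q 2 \<noteq> 0"
    and res: "pencil_resultant ?P ?Q ?X ?Y \<noteq> 0"
    using gp by (auto simp: general_position_poly_def Let_def D_def p_def q_def x_def y_def)
  \<comment> \<open>The omitted denominator reappears as the factor \<open>D\<close>, which is
    harmless for membership in a subspace.\<close>
  have vector: "(\<Sum>i\<in>UNIV. frame_coord \<omega> v i *s e i) = D *s v" for v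
    using frame_coord_sum[of \<omega> v] D by (simp add: D_def e_def)
  have sub: "vec.subspace (L k)" for k using L by (auto simp: G26_def)
  have "e 0 \<in> L 0" "e 3 \<in> L 0" "e 1 \<in> L 1" "e 4 \<in> L 1" "e 2 \<in> L 2" "e 5 \<in> L 2"
    by (simp_all add: e_def frame_def line_of_def contractions_in_line[OF rep])
  then have span012: "vec.span {e 0, e 3} \<subseteq> L 0" "vec.span {e 1, e 4} \<subseteq> L 1" "vec.span {e 2, e 5} \<subseteq> L 2"
    by (simp_all add: vec.span_minimal sub)
  have "D *s p \<in> L 3" "D *s q \<in> L 3" "D *s x \<in> L 4" "D *s y \<in> L 4"
    by (simp_all add: p_def q_def x_def y_def contractions_in_line[OF rep] vec.subspace_scale sub)
  then have span34: "vec.span {D *s p, D *s q} \<subseteq> L 3" "vec.span {D *s x, D *s y} \<subseteq> L 4"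
    by (simp_all add: vec.span_minimal sub)
  obtain \<epsilon> u v a e1 e2 where basis: "basis6 \<epsilon>" and mem:
    "\<epsilon> 0 \<in> vec.span {e 0, e 3}" "\<epsilon> 3 \<in> vec.span {e 0, e 3}"
    "\<epsilon> 1 \<in> vec.span {e 1, e 4}" "\<epsilon> 4 \<in> vec.span {e 1, e 4}"
    "\<epsilon> 2 \<in> vec.span {e 2, e 5}" "\<epsilon> 5 \<in> vec.span {e 2, e 5}"
    "\<epsilon> 0 + \<epsilon> 1 + \<epsilon> 2 \<in> vec.span {D *s p, D *s q}"
    "\<epsilon> 3 + \<epsilon> 4 + \<epsilon> 5 \<in> vec.span {D *s p, D *s q}"
    "- \<epsilon> 0 + v *s \<epsilon> 4 - \<epsilon> 5 \<in> vec.span {D *s x, D *s y}"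
    "u *s \<epsilon> 1 - \<epsilon> 2 + a *s \<epsilon> 3 + e1 *s \<epsilon> 4 + e2 *s \<epsilon> 5 \<in> vec.span {D *s x, D *s y}"
    by (rule frame_normal_form[OF span_frame[of \<omega>, folded D_def e_def, OF D] minor res, unfolded vector])
  have zero: "c0 = 0 \<and> c1 = 0 \<and> c2 = 0 \<and> c3 = 0 \<and> c4 = 0 \<and> c5 = 0"
    if "c0 *s \<epsilon> 0 + c1 *s \<epsilon> 1 + c2 *s \<epsilon> 2 + c3 *s \<epsilon> 3 + c4 *s \<epsilon> 4 + c5 *s \<epsilon> 5 = 0" for c0 c1 c2 c3 c4 c5
  proof -
    define c :: "6 \<Rightarrow> complex" where "c i = (if i = 0 then c0 else if i = 1 then c1 else if i = 2 then c2
      else if i = 3 then c3 else if i = 4 then c4 else c5)" for i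
    have "(\<Sum>i\<in>UNIV. c i *s \<epsilon> i) = 0" using that by (simp add: sum_6 c_def)
    from basis6_sum_eq_0[OF basis this] have "c 0 = 0" "c 1 = 0" "c 2 = 0" "c 3 = 0" "c 4 = 0" "c 5 = 0" by blast+
    then show ?thesis by (simp add: c_def)
  qed
  show thesis
  proof (rule that[OF basis])
    show "represents (\<epsilon> 0 \<and>\<and> \<epsilon> 3) (L 0)"
      using mem span012 L zero[of _ 0 0 _ 0 0] by (intro representsI) auto
    show "represents (\<epsilon> 1 \<and>\<and> \<epsilon> 4) (L 1)"
      using mem span012 L zero[of 0 _ 0 0 _ 0] by (intro representsI) auto
    show "represents (\<epsilon> 2 \<and>\<and> \<epsilon> 5) (L 2)"
      using mem span012 L zero[of 0 0 _ 0 0 _] by (intro representsI) auto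
    show "represents ((\<epsilon> 0 + \<epsilon> 1 + \<epsilon> 2) \<and>\<and> (\<epsilon> 3 + \<epsilon> 4 + \<epsilon> 5)) (L 3)"
    proof (rule representsI)
      fix \<alpha> \<beta> assume "\<alpha> *s (\<epsilon> 0 + \<epsilon> 1 + \<epsilon> 2) + \<beta> *s (\<epsilon> 3 + \<epsilon> 4 + \<epsilon> 5) = 0"
      then show "\<alpha> = 0 \<and> \<beta> = 0"
        using zero[of \<alpha> \<alpha> \<alpha> \<beta> \<beta> \<beta>] by (simp add: vec.scale_right_distrib add_ac)
    qed (use mem span34 L in auto)
    show "represents ((- \<epsilon> 0 + v *s \<epsilon> 4 - \<epsilon> 5) \<and>\<and>
      (u *s \<epsilon> 1 - \<epsilon> 2 + a *s \<epsilon> 3 + e1 *s \<epsilon> 4 + e2 *s \<epsilon> 5)) (L 4)"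
    proof (rule representsI)
      fix \<alpha> \<beta> assume *: "\<alpha> *s (- \<epsilon> 0 + v *s \<epsilon> 4 - \<epsilon> 5)
        + \<beta> *s (u *s \<epsilon> 1 - \<epsilon> 2 + a *s \<epsilon> 3 + e1 *s \<epsilon> 4 + e2 *s \<epsilon> 5) = 0"
      have "(- \<alpha>) *s \<epsilon> 0 + (\<beta> * u) *s \<epsilon> 1 + (- \<beta>) *s \<epsilon> 2 + (\<beta> * a) *s \<epsilon> 3
        + (\<alpha> * v + \<beta> * e1) *s \<epsilon> 4 + (\<beta> * e2 - \<alpha>) *s \<epsilon> 5 = 0"
        unfolding *[symmetric] by (simp add: vec_eq_iff algebra_simps)
      \<comment> \<open>The coefficients at \<open>\<epsilon> 0\<close> and
        \<open>\<epsilon> 2\<close> are \<open>- \<alpha>\<close> and \<open>- \<beta>\<close>,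
        whatever the parameters are.\<close>
      from zero[OF this] show "\<alpha> = 0 \<and> \<beta> = 0" by simp
    qed (use mem span34 L in auto)
  qed
qed

lemma general_position_nonempty:
  obtains L \<omega> where "L \<in> G26_pow5" "\<forall>k. represents (\<omega> k) (L k)" "general_position_poly \<omega> \<noteq> 0"
proof -
  define b :: "6 \<Rightarrow> V6" where "b i = axis i 1" for i
  have b: "b i $ j = of_bool (j = i)" for i j by (simp add: b_def axis_def)
  \<comment> \<open>For the fifth line the pencils of projections are \<open>(s, t)\<close>, \<open>(t, s)\<close>, \<open>(s, 2 * t)\<close>, so the two
      quadratic forms are \<open>2 * t\<^sup>2 - s\<^sup>2\<close> and \<open>s * t\<close>, which have no common root.\<close>
  define x y :: "5 \<Rightarrow> V6" where
    "x k = (if k = 0 then b 0 else if k = 1 then b 1 else if k = 2 then b 2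
       else if k = 3 then b 0 + b 1 + b 2 else b 0 + b 2 + b 4)" and
    "y k = (if k = 0 then b 3 else if k = 1 then b 4 else if k = 2 then b 5
       else if k = 3 then b 3 + b 4 + b 5 else b 3 + b 1 + 2 *s b 5)" for k
  \<comment> \<open>At the positions \<open>r k\<close> and \<open>r k + 3\<close> the pair
    \<open>x k\<close>, \<open>y k\<close> is an identity matrix. This gives independence, and the
    matching contractions return \<open>x k\<close> and \<open>y k\<close> themselves.\<close>
  define r :: "5 \<Rightarrow> 6" where "r k = (if k = 1 then 1 else if k = 2 then 2 else 0)" for k
  have xy: "x k $ r k = 1" "x k $ (r k + 3) = 0" "y k $ r k = 0" "y k $ (r k + 3) = 1" for k
    by (simp_all add: x_def y_def r_def b)
  define \<omega> where "\<omega> k = x k \<and>\<and> y k" for k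
  define L where "L k = vec.span {x k, y k}" for k
  have "\<alpha> = 0 \<and> \<beta> = 0" if "\<alpha> *s x k + \<beta> *s y k = 0" for \<alpha> \<beta> k
  proof -
    have "(\<alpha> *s x k + \<beta> *s y k) $ r k = 0" "(\<alpha> *s x k + \<beta> *s y k) $ (r k + 3) = 0"
      unfolding that by simp_all
    then show ?thesis by (simp add: xy)
  qed
  then have L: "L k \<in> G26 \<and> represents (\<omega> k) (L k)" for k
    unfolding L_def \<omega>_def by (rule span_pair_in_G26)
  have rc: "right_contraction (r k + 3) (\<omega> k) = x k" and lc: "left_contraction (r k) (\<omega> k) = y k" for k
    by (simp_all add: right_contraction_def left_contraction_def \<omega>_def wedge_def xy vec_eq_iff)
  have frame: "frame \<omega> i = b i" for i
  proof -
    have "i \<in> {0, 1, 2, 3, 4, 5}" unfolding UNIV_6[symmetric] by simp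
    then show ?thesis
      using rc[of 0] rc[of 1] rc[of 2] lc[of 0] lc[of 1] lc[of 2]
      by (elim insertE) (simp_all add: frame_def line_of_def r_def x_def y_def add_3_wraparound)
  qed
  have mat: "frame_matrix \<omega> = mat 1"
    by (simp add: frame_matrix_def frame b mat_def vec_eq_iff)
  \<comment> \<open>The frame is the standard basis, so Cramer's numerators are the ordinary
    coordinates.\<close>
  have coord: "frame_coord \<omega> v = ($) v" for v
    using cramer_lemma[of _ "mat 1 :: complex^6^6" v]
    unfolding frame_coord_def mat matrix_vector_mul_lid by (simp add: fun_eq_iff)
  have 34: "right_contraction 3 (\<omega> 3) = b 0 + b 1 + b 2" "left_contraction 0 (\<omega> 3) = b 3 + b 4 + b 5"
    "right_contraction 3 (\<omega> 4) = b 0 + b 2 + b 4" "left_contraction 0 (\<omega> 4) = b 3 + b 1 + 2 *s b 5"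
    using rc[of 3] rc[of 4] lc[of 3] lc[of 4] by (simp_all add: r_def x_def y_def)
  have "general_position_poly \<omega> \<noteq> 0"
    by (simp add: general_position_poly_def Let_def mat coord 34 minor_def pencil_resultant_def
        pencil_bracket_def quad_resultant_def b)
  with L show thesis by (intro that[of L \<omega>]) (simp_all add: G26_pow5_def)
qed

theorem corollary4p10:
  "\<exists>U. zariski_open U \<and> U \<noteq> {} \<and>
    (\<forall>L\<in>U. \<exists>(\<epsilon> :: 6 \<Rightarrow> V6) (u::complex) (v::complex) (a124::complex) (e1::complex) (e2::complex).
      basis6 \<epsilon> \<and>
      represents (\<epsilon> 0 \<and>\<and> \<epsilon> 3) (L 0) \<and>
      represents (\<epsilon> 1 \<and>\<and> \<epsilon> 4) (L 1) \<and>
      represents (\<epsilon> 2 \<and>\<and> \<epsilon> 5) (L 2) \<and>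
      represents ((\<epsilon> 0 + \<epsilon> 1 + \<epsilon> 2) \<and>\<and> (\<epsilon> 3 + \<epsilon> 4 + \<epsilon> 5)) (L 3) \<and>
      represents ((- \<epsilon> 0 + v *s \<epsilon> 4 - \<epsilon> 5) \<and>\<and>
        (u *s \<epsilon> 1 - \<epsilon> 2 + a124 *s \<epsilon> 3 + e1 *s \<epsilon> 4 + e2 *s \<epsilon> 5)) (L 4))"
proof -
  \<comment> \<open>With the existential over representing tensors, the complement is literally the
    zero locus of the single polynomial, where every representing tensor must give 0.\<close>
  define U where "U = {L \<in> G26_pow5. \<exists>\<omega>. (\<forall>k. represents (\<omega> k) (L k)) \<and> general_position_poly \<omega> \<noteq> 0}"
  have "zariski_open U"
    unfolding zariski_open_def zariski_closed_def
  proof (intro conjI exI[of _ "{general_position_poly}"])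
    show "\<forall>f\<in>{general_position_poly}. \<exists>d. multihomogeneous d f"
      using multihomogeneous_general_position by simp
  qed (auto simp: U_def)
  moreover have "U \<noteq> {}"
  proof -
    obtain L \<omega> where "L \<in> G26_pow5" "\<forall>k. represents (\<omega> k) (L k)" "general_position_poly \<omega> \<noteq> 0"
      by (rule general_position_nonempty)
    then have "L \<in> U" unfolding U_def by blast
    then show ?thesis by blast
  qed
  moreover have "\<exists>(\<epsilon> :: 6 \<Rightarrow> V6) (u::complex) (v::complex) (a124::complex) (e1::complex) (e2::complex).
      basis6 \<epsilon> \<and>
      represents (\<epsilon> 0 \<and>\<and> \<epsilon> 3) (L 0) \<and>
      represents (\<epsilon> 1 \<and>\<and> \<epsilon> 4) (L 1) \<and>
      represents (\<epsilon> 2 \<and>\<and> \<epsilon> 5) (L 2) \<and>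
      represents ((\<epsilon> 0 + \<epsilon> 1 + \<epsilon> 2) \<and>\<and> (\<epsilon> 3 + \<epsilon> 4 + \<epsilon> 5)) (L 3) \<and>
      represents ((- \<epsilon> 0 + v *s \<epsilon> 4 - \<epsilon> 5) \<and>\<and>
        (u *s \<epsilon> 1 - \<epsilon> 2 + a124 *s \<epsilon> 3 + e1 *s \<epsilon> 4 + e2 *s \<epsilon> 5)) (L 4)"
    if "L \<in> U" for L
  proof -
    from that obtain \<omega> where "L \<in> G26_pow5" "\<forall>k. represents (\<omega> k) (L k)" "general_position_poly \<omega> \<noteq> 0"
      unfolding U_def by blast
    then show ?thesis by (rule normal_form_of_general_position) blast
  qed
  ultimately show ?thesis by blast
qed

end
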